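(* Let $T:\mathcal{S}(\mathbb{R}^d)\to\mathcal{S}'(\mathbb{R}^d)$ be a linear and continuous map with Schwartz kernel $k_T\in\mathcal{S}'(\mathbb{R}^{2d})$, let $g(t)=e^{-\pi|t|^2}$, $t\in\mathbb{R}^d$, and let $h(z,w)=\langle T\pi(z)g,\pi(w)g\rangle$ be the Gabor matrix of $T$. Then $$|h(z,w)|=|V_\Psi k_T(x,y,\xi,-\eta)|,\qquad z=(x,\xi),\ w=(y,\eta)\in\mathbb{R}^{2d},$$ where $V_\Psi$ is the short-time Fourier transform on $\mathbb{R}^{2d}$ with window $\Psi(x,y)=e^{-\pi(|x|^2+|y|^2)}$. Assume further that $T=\sigma(D)$ is the Fourier multiplier with symbol $\sigma\in\mathcal{S}'(\mathbb{R}^d)$, and let $E=\mathcal{F}^{-1}\sigma\in\mathcal{S}'(\mathbb{R}^d)$. Then $$|h(z,w)|=\left|\int_{\mathbb{R}^d}H(x,y,\xi,\eta,r)E(r)\,dr\right|,$$ where $H(x,y,\xi,\eta,\cdot)\in\mathcal{S}(\mathbb{R}^d_r)$ satisfies $$|H(x,y,\xi,\eta,r)|=2^{-d/2}\exp\left(-\frac\pi2\left(|\xi-\eta|^2+|x-y-r|^2\right)\right).$$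
   Context: Fourier transform: $\widehat f(\xi)=\mathcal{F}f(\xi)=\int f(x)e^{-2\pi i x\cdot\xi}dx$; $\sigma(D)f=\mathcal{F}^{-1}(\sigma\widehat f)=E*f$. Time-frequency shifts: $\pi(x,\xi)f(t)=e^{2\pi i\xi\cdot t}f(t-x)$. $\langle\cdot,\cdot\rangle$ is the duality extending the $L^2$ inner product (antilinear in the second entry). The Schwartz kernel of $T$ is the unique $k_T\in\mathcal{S}'(\mathbb{R}^{2d})$ with $\langle Tf,g\rangle=\langle k_T,g\otimes\bar f\rangle$ for $f,g\in\mathcal{S}(\mathbb{R}^d)$, where $(f\otimes g)(x,y)=f(x)g(y)$. Short-time Fourier transform on $\mathbb{R}^{2d}$: $V_\Psi F(p,q)=\langle F,\pi(p,q)\Psi\rangle=\int_{\mathbb{R}^{2d}}F(u)\overline{\Psi(u-p)}e^{-2\pi i q\cdot u}du$, here with $p=(x,y)$, $q=(\xi,-\eta)$. The integral against $E$ is a distributional pairing.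
   Formalization: The labels of z and w are interchanged: the formulas are proved for z=(y,η), w=(x,ξ), since with z=(x,ξ), w=(y,η) both displayed identities for |h(z,w)| fail, e.g. for the translation Tf(t)=f(t-1). *)

theory Defs
  imports "HOL-Analysis.Analysis"
begin

section \<open>Schwartz functions\<close>

text \<open>A multi-index is encoded as a list of basis vectors, so
  \<open>iter_partial bs f\<close> is the derivative \<open>\<partial>\<^sup>\<beta> f\<close> where \<open>\<beta>\<close> counts the occurrences of each
  basis vector in \<open>bs\<close>.\<close>

primrec iter_partial :: "'a::euclidean_space list \<Rightarrow> ('a \<Rightarrow> complex) \<Rightarrow> 'a \<Rightarrow> complex" where
  "iter_partial [] f = f"
| "iter_partial (b # bs) f = (\<lambda>x. frechet_derivative (iter_partial bs f) (at x) b)"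

text \<open>Total differentiability of all iterated partial derivatives is smoothness: it makes each
  of them continuous.\<close>

definition smooth :: "('a::euclidean_space \<Rightarrow> complex) \<Rightarrow> bool" where
  "smooth f \<longleftrightarrow> (\<forall>bs\<in>lists Basis. \<forall>x. iter_partial bs f differentiable (at x))"

definition schwartz :: "('a::euclidean_space \<Rightarrow> complex) set" where
  "schwartz = {f. smooth f \<and>
     (\<forall>k. \<forall>bs\<in>lists Basis. bounded (range (\<lambda>x. norm x ^ k *\<^sub>R iter_partial bs f x)))}"

definition schwartz_seminorm :: "nat \<Rightarrow> 'a::euclidean_space list \<Rightarrow> ('a \<Rightarrow> complex) \<Rightarrow> real" where
  "schwartz_seminorm k bs f = (SUP x. norm x ^ k * norm (iter_partial bs f x))"

definition schwartz_topology :: "('a::euclidean_space \<Rightarrow> complex) topology" where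
  "schwartz_topology = topology_generated_by
     {{g \<in> schwartz. schwartz_seminorm k bs (\<lambda>x. g x - f x) < e} | f k bs e.
        f \<in> schwartz \<and> bs \<in> lists Basis \<and> e > 0}"


section \<open>Tempered distributions\<close>

text \<open>A tempered distribution is a complex-linear continuous functional on \<^const>\<open>schwartz\<close>.
  Membership in \<^const>\<open>extensional\<close> fixes its value outside \<^const>\<open>schwartz\<close>, so that HOL
  equality is equality of distributions. A function \<open>F\<close> acts by \<open>\<phi> \<mapsto> \<integral> F \<phi>\<close>, without
  conjugation.\<close>

definition tempered :: "(('a::euclidean_space \<Rightarrow> complex) \<Rightarrow> complex) set" where
  "tempered = {u \<in> extensional schwartz.
     continuous_map schwartz_topology euclidean u \<and>
     (\<forall>\<phi>\<in>schwartz. \<forall>\<psi>\<in>schwartz. u (\<lambda>x. \<phi> x + \<psi> x) = u \<phi> + u \<psi>) \<and>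
     (\<forall>c. \<forall>\<phi>\<in>schwartz. u (\<lambda>x. c * \<phi> x) = c * u \<phi>)}"

text \<open>The weak-* topology. Linear maps out of the Frechet space of Schwartz functions are
  continuous for it iff they are continuous for the strong dual topology.\<close>

definition tempered_topology :: "(('a::euclidean_space \<Rightarrow> complex) \<Rightarrow> complex) topology" where
  "tempered_topology = subtopology (product_topology (\<lambda>_. euclidean) schwartz) tempered"

text \<open>The duality extending the \<open>L\<^sup>2\<close> inner product, antilinear in the second entry.\<close>

definition pairing :: "(('a \<Rightarrow> complex) \<Rightarrow> complex) \<Rightarrow> ('a \<Rightarrow> complex) \<Rightarrow> complex" where
  "pairing u \<phi> = u (\<lambda>x. cnj (\<phi> x))"

definition linear_continuous_operator ::
  "(('a::euclidean_space \<Rightarrow> complex) \<Rightarrow> (('a \<Rightarrow> complex) \<Rightarrow> complex)) \<Rightarrow> bool" where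
  "linear_continuous_operator T \<longleftrightarrow>
     continuous_map schwartz_topology tempered_topology T \<and>
     (\<forall>f\<in>schwartz. \<forall>g\<in>schwartz. \<forall>\<phi>\<in>schwartz. T (\<lambda>x. f x + g x) \<phi> = T f \<phi> + T g \<phi>) \<and>
     (\<forall>c. \<forall>f\<in>schwartz. \<forall>\<phi>\<in>schwartz. T (\<lambda>x. c * f x) \<phi> = c * T f \<phi>)"


section \<open>Schwartz kernel, Gabor matrix, short-time Fourier transform\<close>

definition tensor :: "('a \<Rightarrow> complex) \<Rightarrow> ('b \<Rightarrow> complex) \<Rightarrow> 'a \<times> 'b \<Rightarrow> complex" where
  "tensor f g = (\<lambda>(x, y). f x * g y)"

text \<open>The first variable of the kernel is the output variable of the operator. Hence
  \<open>\<langle>T \<pi>(z) g, \<pi>(w) g\<rangle>\<close> is the short-time Fourier transform of the kernel at \<open>((x, y), (\<xi>, - \<eta>))\<close> for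
  \<open>z = (y, \<eta>)\<close> and \<open>w = (x, \<xi>)\<close>; with \<open>z\<close> and \<open>w\<close> interchanged this fails, for instance for
  translations.\<close>

definition is_schwartz_kernel ::
  "(('a::euclidean_space \<Rightarrow> complex) \<Rightarrow> (('a \<Rightarrow> complex) \<Rightarrow> complex)) \<Rightarrow>
   (('a \<times> 'a \<Rightarrow> complex) \<Rightarrow> complex) \<Rightarrow> bool" where
  "is_schwartz_kernel T k \<longleftrightarrow> k \<in> tempered \<and>
     (\<forall>f\<in>schwartz. \<forall>g\<in>schwartz. pairing (T f) g = pairing k (tensor g (\<lambda>y. cnj (f y))))"

definition tf_shift :: "'a::euclidean_space \<times> 'a \<Rightarrow> ('a \<Rightarrow> complex) \<Rightarrow> 'a \<Rightarrow> complex" where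
  "tf_shift = (\<lambda>(x, \<xi>) f t. cis (2 * pi * (\<xi> \<bullet> t)) * f (t - x))"

definition stft ::
  "('a::euclidean_space \<Rightarrow> complex) \<Rightarrow> (('a \<Rightarrow> complex) \<Rightarrow> complex) \<Rightarrow> 'a \<times> 'a \<Rightarrow> complex" where
  "stft \<Psi> F pq = pairing F (tf_shift pq \<Psi>)"

definition gabor_matrix ::
  "('a::euclidean_space \<Rightarrow> complex) \<Rightarrow> (('a \<Rightarrow> complex) \<Rightarrow> (('a \<Rightarrow> complex) \<Rightarrow> complex)) \<Rightarrow>
   'a \<times> 'a \<Rightarrow> 'a \<times> 'a \<Rightarrow> complex" where
  "gabor_matrix g T z w = pairing (T (tf_shift z g)) (tf_shift w g)"

definition gaussian :: "'a::euclidean_space \<Rightarrow> complex" where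
  "gaussian t = of_real (exp (- pi * (norm t)\<^sup>2))"


section \<open>Fourier transform and Fourier multipliers\<close>

definition fourier :: "('a::euclidean_space \<Rightarrow> complex) \<Rightarrow> 'a \<Rightarrow> complex" where
  "fourier f \<xi> = (LINT x|lborel. f x * cis (- 2 * pi * (x \<bullet> \<xi>)))"

definition inv_fourier :: "('a::euclidean_space \<Rightarrow> complex) \<Rightarrow> 'a \<Rightarrow> complex" where
  "inv_fourier f x = (LINT \<xi>|lborel. f \<xi> * cis (2 * pi * (x \<bullet> \<xi>)))"

definition tempered_inv_fourier ::
  "(('a::euclidean_space \<Rightarrow> complex) \<Rightarrow> complex) \<Rightarrow> (('a \<Rightarrow> complex) \<Rightarrow> complex)" where
  "tempered_inv_fourier u = (\<lambda>\<phi>\<in>schwartz. u (inv_fourier \<phi>))"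

definition tempered_times ::
  "('a::euclidean_space \<Rightarrow> complex) \<Rightarrow> (('a \<Rightarrow> complex) \<Rightarrow> complex) \<Rightarrow> (('a \<Rightarrow> complex) \<Rightarrow> complex)"
  where "tempered_times \<psi> u = (\<lambda>\<phi>\<in>schwartz. u (\<lambda>x. \<psi> x * \<phi> x))"

definition fourier_multiplier ::
  "(('a::euclidean_space \<Rightarrow> complex) \<Rightarrow> complex) \<Rightarrow> ('a \<Rightarrow> complex) \<Rightarrow> (('a \<Rightarrow> complex) \<Rightarrow> complex)"
  where "fourier_multiplier \<sigma> f = tempered_inv_fourier (tempered_times (fourier f) \<sigma>)"

end

theory Submission
  imports Defs "HOL-Probability.Characteristic_Functions"
begin

text \<open>
  Every function in sight is a Gaussian that has been dilated, translated and modulated, a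
  \<open>gabor_atom\<close>. Two facts about this family give the result: its members are Schwartz
  functions (\<open>schwartz_gabor_atom\<close>), so that the distributional pairings are the expected ones,
  and the inverse Fourier transform maps the family to itself with an explicit factor
  (\<open>inv_fourier_gabor_atom\<close>).

  For the kernel, the tensor product of \<open>\<pi>(x, \<xi>) g\<close> with the conjugate of \<open>\<pi>(y, \<eta>) g\<close> is the
  time-frequency shift by \<open>((x, y), (\<xi>, - \<eta>))\<close> of the Gaussian on the product space. The Gabor matrix
  and the short-time Fourier transform of the kernel are therefore equal, phases included.

  For a multiplier with symbol \<open>\<sigma>\<close>, the Gabor matrix is \<open>\<sigma>\<close> applied to the product of the Fourier
  transform of \<open>\<pi>(y, \<eta>) g\<close>, a Gaussian centred at \<open>\<eta>\<close>, and the inverse Fourier transform of the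
  conjugate of \<open>\<pi>(x, \<xi>) g\<close>, a Gaussian centred at \<open>\<xi>\<close>. By the parallelogram law this product is, up
  to phases, a narrower Gaussian centred at the midpoint \<open>(\<xi> + \<eta>) / 2\<close>, times
  \<open>exp (- (\<pi> / 2) |\<xi> - \<eta>|\<^sup>2)\<close>. It is hence the inverse Fourier transform of a wider Gaussian
  centred at \<open>x - y\<close>, which is the function \<open>H\<close>; passing \<open>\<F>\<^sup>-\<^sup>1\<close> from this function to \<open>\<sigma>\<close>
  turns \<open>\<sigma>\<close> into \<open>E\<close>.
\<close>

section \<open>Gabor atoms\<close>

text \<open>The parameter \<open>a\<close> is the inverse square of the width, \<open>x\<close> the centre and \<open>v\<close> the frequency.
  Width \<open>1\<close> is that of the window; the Fourier side needs the values \<open>2\<close> and \<open>1 / 2\<close> of \<open>a\<close> as well.\<close>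

definition gabor_atom :: "real \<Rightarrow> 'a::euclidean_space \<Rightarrow> 'a \<Rightarrow> 'a \<Rightarrow> complex" where
  "gabor_atom a x v t = cis (2 * pi * (v \<bullet> t)) * of_real (exp (- pi * a * (norm (t - x))\<^sup>2))"

lemma norm_gabor_atom: "norm (gabor_atom a x v t) = exp (- pi * a * (norm (t - x))\<^sup>2)"
  by (simp add: gabor_atom_def norm_mult)

lemma tf_shift_gaussian: "tf_shift (x, \<xi>) gaussian = gabor_atom 1 x \<xi>"
  by (simp add: fun_eq_iff tf_shift_def gaussian_def gabor_atom_def)

lemma cnj_gabor_atom: "cnj (gabor_atom a x v t) = gabor_atom a x (- v) t"
  by (simp add: gabor_atom_def cis_cnj)

section \<open>Gabor atoms are Schwartz functions\<close>

text \<open>The estimates defining \<^const>\<open>schwartz\<close> quantify over all iterated derivatives. For a class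
  of functions closed under differentiation it suffices to check them without derivatives.\<close>

lemma schwartz_coinduct:
  assumes "f \<in> S"
    and diff: "\<And>f x. f \<in> S \<Longrightarrow> f differentiable (at x)"
    and partial: "\<And>f b. f \<in> S \<Longrightarrow> b \<in> Basis \<Longrightarrow> (\<lambda>x. frechet_derivative f (at x) b) \<in> S"
    and decay: "\<And>f k. f \<in> S \<Longrightarrow> bounded (range (\<lambda>x. norm x ^ k *\<^sub>R f x))"
  shows "f \<in> schwartz"
proof -
  have "iter_partial bs f \<in> S" if "bs \<in> lists Basis" for bs
    using that by induction (auto simp: \<open>f \<in> S\<close> partial)
  then show ?thesis
    by (auto simp: schwartz_def smooth_def diff decay)
qed

text \<open>Derivatives of a Gabor atom are polynomial multiples of it, so polynomial multiples of Gabor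
  atoms form a class closed under differentiation. A rule-based definition lets closure under
  derivatives and polynomial growth be proved by induction, without multi-indices.\<close>

inductive complex_polynomial :: "('a::euclidean_space \<Rightarrow> complex) \<Rightarrow> bool" where
  const: "complex_polynomial (\<lambda>_. c)"
| linear: "complex_polynomial (\<lambda>t. of_real (t \<bullet> u))"
| add: "complex_polynomial p \<Longrightarrow> complex_polynomial q \<Longrightarrow> complex_polynomial (\<lambda>t. p t + q t)"
| mult: "complex_polynomial p \<Longrightarrow> complex_polynomial q \<Longrightarrow> complex_polynomial (\<lambda>t. p t * q t)"

lemma complex_polynomial_has_derivative:
  assumes "complex_polynomial p"
  obtains p' where "\<And>t. (p has_derivative (\<lambda>h. p' h t)) (at t)"
    and "\<And>h. complex_polynomial (p' h)"
proof -
  have "\<exists>p'. (\<forall>t. (p has_derivative (\<lambda>h. p' h t)) (at t)) \<and> (\<forall>h. complex_polynomial (p' h))"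
    using assms
  proof induction
    case (const c)
    show ?case
      by (rule exI[of _ "\<lambda>_ _. 0"]) (auto intro: complex_polynomial.const)
  next
    case (linear u)
    have "((\<lambda>t. complex_of_real (t \<bullet> u)) has_derivative (\<lambda>h. of_real (h \<bullet> u))) (at t)" for t
      by (auto intro!: derivative_eq_intros)
    then show ?case
      by (intro exI[of _ "\<lambda>h _. of_real (h \<bullet> u)"]) (auto intro: complex_polynomial.const)
  next
    case (add p q)
    then obtain p' q' where
      "\<And>t. (p has_derivative (\<lambda>h. p' h t)) (at t)" "\<And>h. complex_polynomial (p' h)"
      "\<And>t. (q has_derivative (\<lambda>h. q' h t)) (at t)" "\<And>h. complex_polynomial (q' h)"
      by blast
    then show ?case
      by (intro exI[of _ "\<lambda>h t. p' h t + q' h t"])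
        (auto intro: complex_polynomial.intros has_derivative_add)
  next
    case (mult p q)
    then obtain p' q' where
      "\<And>t. (p has_derivative (\<lambda>h. p' h t)) (at t)" "\<And>h. complex_polynomial (p' h)"
      "\<And>t. (q has_derivative (\<lambda>h. q' h t)) (at t)" "\<And>h. complex_polynomial (q' h)"
      by blast
    with mult.hyps show ?case
      by (intro exI[of _ "\<lambda>h t. p t * q' h t + p' h t * q t"])
        (auto intro: has_derivative_mult intro!: complex_polynomial.add complex_polynomial.mult)
  qed
  then show ?thesis
    using that by blast
qed

lemma complex_polynomial_growth:
  assumes "complex_polynomial p"
  obtains C n where "\<And>t. norm (p t) \<le> C * (1 + norm t) ^ n"
proof -
  have "\<exists>C n. \<forall>t. norm (p t) \<le> C * (1 + norm t) ^ n"
    using assms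
  proof induction
    case (const c)
    show ?case
      by (rule exI[of _ "norm c"], rule exI[of _ 0]) simp
  next
    case (linear u)
    have "\<bar>t \<bullet> u\<bar> \<le> norm u * (1 + norm t) ^ 1" for t
      using Cauchy_Schwarz_ineq2[of t u] by (simp add: algebra_simps add_increasing)
    then show ?case
      by (intro exI[of _ "norm u"] exI[of _ 1]) simp
  next
    case (add p q)
    then obtain C m D n where
      p: "\<And>t. norm (p t) \<le> C * (1 + norm t) ^ m" and q: "\<And>t. norm (q t) \<le> D * (1 + norm t) ^ n"
      by blast
    have "norm (p t + q t) \<le> (\<bar>C\<bar> + \<bar>D\<bar>) * (1 + norm t) ^ (m + n)" for t
    proof -
      have "norm (p t) \<le> \<bar>C\<bar> * (1 + norm t) ^ (m + n)"
        by (rule order_trans[OF p]) (intro mult_mono power_increasing; simp)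
      moreover have "norm (q t) \<le> \<bar>D\<bar> * (1 + norm t) ^ (m + n)"
        by (rule order_trans[OF q]) (intro mult_mono power_increasing; simp)
      ultimately show ?thesis
        using norm_triangle_ineq[of "p t" "q t"] by (simp add: algebra_simps)
    qed
    then show ?case by blast
  next
    case (mult p q)
    then obtain C m D n where
      p: "\<And>t. norm (p t) \<le> C * (1 + norm t) ^ m" and q: "\<And>t. norm (q t) \<le> D * (1 + norm t) ^ n"
      by blast
    have "norm (p t * q t) \<le> (C * D) * (1 + norm t) ^ (m + n)" for t
      using mult_mono'[OF p[of t] q[of t]] by (simp add: norm_mult power_add mult_ac)
    then show ?case by blast
  qed
  then show ?thesis
    using that by blast
qed

text \<open>Completing the square bounds the Gaussian by a multiple of \<open>exp (- u)\<close>, and the exponential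
  series bounds the \<open>n\<close>-th power by \<open>n!\<close> times an exponential. The shift \<open>c\<close> allows for a
  Gaussian that is centred away from the origin.\<close>

lemma power_gaussian_bounded:
  fixes a c :: real
  assumes "0 < a" "0 \<le> c"
  obtains B where "\<And>u. 0 \<le> u \<Longrightarrow> (c + u) ^ n * exp (- a * u\<^sup>2) \<le> B"
proof
  fix u :: real
  assume u: "0 \<le> u"
  have "0 \<le> a * (u - 1 / (2 * a))\<^sup>2"
    using assms by simp
  also have "a * (u - 1 / (2 * a))\<^sup>2 = a * u\<^sup>2 - u + 1 / (4 * a)"
    using assms by (simp add: power2_eq_square field_simps)
  finally have square: "- a * u\<^sup>2 \<le> 1 / (4 * a) + c - (c + u)"
    by simp
  have "(c + u) ^ n /\<^sub>R fact n \<le> exp (c + u)"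
    unfolding exp_def using sum_le_suminf[OF summable_exp_generic, of "{n}" "c + u"] assms u by simp
  then have "(c + u) ^ n \<le> fact n * exp (c + u)"
    by (simp add: field_simps)
  then have "(c + u) ^ n * exp (- a * u\<^sup>2) \<le> (fact n * exp (c + u)) * exp (1 / (4 * a) + c - (c + u))"
    using square assms u by (intro mult_mono) auto
  also have "\<dots> = fact n * exp (1 / (4 * a) + c)"
    by (simp flip: exp_add)
  finally show "(c + u) ^ n * exp (- a * u\<^sup>2) \<le> fact n * exp (1 / (4 * a) + c)" .
qed

lemma gabor_atom_has_derivative:
  "(gabor_atom a x v has_derivative
     (\<lambda>h. (\<i> * of_real (2 * pi * (v \<bullet> h)) - of_real (2 * pi * a * ((t - x) \<bullet> h))) *
       gabor_atom a x v t)) (at t)"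
proof -
  have exp_form: "gabor_atom a x v =
      (\<lambda>t. exp (\<i> * of_real (2 * pi * (v \<bullet> t)) - of_real (pi * a * ((t - x) \<bullet> (t - x)))))"
    by (simp add: fun_eq_iff gabor_atom_def cis_conv_exp exp_diff exp_minus power2_norm_eq_inner
        divide_inverse mult.assoc flip: exp_of_real)
  have "((\<lambda>t. \<i> * of_real (2 * pi * (v \<bullet> t)) - complex_of_real (pi * a * ((t - x) \<bullet> (t - x)))) has_derivative
      (\<lambda>h. \<i> * of_real (2 * pi * (v \<bullet> h)) - of_real (2 * pi * a * ((t - x) \<bullet> h)))) (at t)"
    by (auto intro!: derivative_eq_intros simp: fun_eq_iff inner_commute algebra_simps)
  from has_derivative_compose[OF this DERIV_exp[unfolded has_field_derivative_def]] show ?thesis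
    by (simp add: exp_form mult.commute)
qed

lemma schwartz_polynomial_gabor_atom:
  assumes "0 < a" "complex_polynomial p"
  shows "(\<lambda>t. p t * gabor_atom a x v t) \<in> schwartz"
proof -
  define F where "F p = (\<lambda>t. p t * gabor_atom a x v t)" for p :: "'a \<Rightarrow> complex"
  define S where "S = F ` Collect complex_polynomial"
  have properties: "f differentiable (at t)" "(\<lambda>t. frechet_derivative f (at t) b) \<in> S"
    "bounded (range (\<lambda>t. norm t ^ k *\<^sub>R f t))" if f_S: "f \<in> S" for f t b k
  proof -
    obtain p where p: "complex_polynomial p" and f: "f = F p"
      using f_S unfolding S_def by blast
    obtain p' where p': "\<And>t. (p has_derivative (\<lambda>h. p' h t)) (at t)" "\<And>h. complex_polynomial (p' h)"
      using complex_polynomial_has_derivative[OF p] by blast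
    \<comment> \<open>The logarithmic derivative of the atom in direction \<open>h\<close>, affine in \<open>t\<close>.\<close>
    define q where "q h t = (\<i> * of_real (2 * pi * (v \<bullet> h)) + of_real (2 * pi * a * (x \<bullet> h)))
      + of_real (- 2 * pi * a) * of_real (t \<bullet> h)" for h t
    have q: "complex_polynomial (q h)" for h
      unfolding q_def by (intro complex_polynomial.intros)
    have f': "(f has_derivative (\<lambda>h. (p' h t + p t * q h t) * gabor_atom a x v t)) (at t)" for t
      unfolding f F_def
      by (rule has_derivative_eq_rhs[OF has_derivative_mult[OF p'(1) gabor_atom_has_derivative]])
        (simp add: q_def fun_eq_iff algebra_simps)
    show "f differentiable (at t)"
      using f' differentiableI by blast
    show "(\<lambda>t. frechet_derivative f (at t) b) \<in> S"
    proof -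
      have "(\<lambda>t. frechet_derivative f (at t) b) = F (\<lambda>t. p' b t + p t * q b t)"
        by (simp add: F_def flip: frechet_derivative_at[OF f'])
      moreover have "complex_polynomial (\<lambda>t. p' b t + p t * q b t)"
        by (intro complex_polynomial.add complex_polynomial.mult p p' q)
      ultimately show ?thesis
        by (simp add: S_def)
    qed
    show "bounded (range (\<lambda>t. norm t ^ k *\<^sub>R f t))"
    proof -
      obtain C n where C: "\<And>t. norm (p t) \<le> C * (1 + norm t) ^ n"
        using complex_polynomial_growth[OF p] by blast
      have "0 \<le> C"
        using order_trans[OF norm_ge_zero C[of 0]] by simp
      \<comment> \<open>The bound is in terms of the distance \<open>u\<close> from the centre \<open>x\<close>, and \<open>norm t \<le> norm x + u\<close>.\<close>
      obtain B where B: "\<And>u. 0 \<le> u \<Longrightarrow> (1 + norm x + u) ^ (k + n) * exp (- (pi * a) * u\<^sup>2) \<le> B"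
        using power_gaussian_bounded[of "pi * a" "1 + norm x"] assms by auto
      have "norm (norm t ^ k *\<^sub>R f t) \<le> C * B" for t
      proof -
        have t: "norm t \<le> norm x + norm (t - x)"
          using norm_triangle_ineq[of x "t - x"] by simp
        have "norm (norm t ^ k *\<^sub>R f t) = norm t ^ k * norm (p t) * exp (- (pi * a) * (norm (t - x))\<^sup>2)"
          by (simp add: f F_def norm_mult norm_gabor_atom)
        also have "\<dots> \<le> (1 + norm x + norm (t - x)) ^ k * (C * (1 + norm x + norm (t - x)) ^ n)
            * exp (- (pi * a) * (norm (t - x))\<^sup>2)"
          using t \<open>0 \<le> C\<close>
          by (intro mult_mono power_mono order_trans[OF C] mult_nonneg_nonneg) auto
        also have "\<dots> = C * ((1 + norm x + norm (t - x)) ^ (k + n) * exp (- (pi * a) * (norm (t - x))\<^sup>2))"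
          by (simp add: power_add mult_ac)
        also have "\<dots> \<le> C * B"
          using B[of "norm (t - x)"] \<open>0 \<le> C\<close> by (intro mult_left_mono) auto
        finally show ?thesis .
      qed
      then show ?thesis
        by (auto simp: bounded_iff)
    qed
  qed
  have "F p \<in> S"
    using assms(2) by (simp add: S_def)
  then show ?thesis
    unfolding F_def[symmetric] by (rule schwartz_coinduct) (erule properties)+
qed

corollary schwartz_gabor_atom:
  assumes "0 < a"
  shows "(\<lambda>t. c * gabor_atom a x v t) \<in> schwartz" and "gabor_atom a x v \<in> schwartz"
proof -
  show *: "(\<lambda>t. c * gabor_atom a x v t) \<in> schwartz" for c
    by (rule schwartz_polynomial_gabor_atom[OF assms complex_polynomial.const])
  show "gabor_atom a x v \<in> schwartz"
    using *[of 1] by simp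
qed

section \<open>Fourier transforms of Gabor atoms\<close>

text \<open>Up to a dilation, this integral is the characteristic function of the standard normal
  distribution.\<close>

lemma integral_gaussian_cis_real:
  fixes a v :: real
  assumes "0 < a"
  shows "integrable lborel (\<lambda>s. of_real (exp (- pi * a * s\<^sup>2)) * cis (2 * pi * (v * s)))" (is "integrable _ ?f")
    and "(LINT s|lborel. of_real (exp (- pi * a * s\<^sup>2)) * cis (2 * pi * (v * s))) =
      complex_of_real (a powr (- 1 / 2) * exp (- pi * v\<^sup>2 / a))"
proof -
  \<comment> \<open>The dilation by \<open>c\<close> turns \<open>exp (- \<pi> a s\<^sup>2)\<close> into \<open>exp (- y\<^sup>2 / 2)\<close>.\<close>
  define c where "c = sqrt (2 * pi * a)"
  have c: "0 < c" "c\<^sup>2 = 2 * pi * a"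
    using assms by (simp_all add: c_def)
  let ?g = "\<lambda>y. std_normal_density y *\<^sub>R iexp (2 * pi * v / c * y)"
  have f_g: "?f s = of_real (sqrt (2 * pi)) * ?g (0 + c * s)" for s
  proof -
    have "(c * s)\<^sup>2 / 2 = pi * a * s\<^sup>2" "2 * pi * v / c * (c * s) = 2 * pi * (v * s)"
      using c by (simp_all add: power_mult_distrib)
    then show ?thesis
      by (simp add: std_normal_density_def cis_conv_exp scaleR_conv_of_real)
  qed
  have "integrable lborel ?g"
    by (rule Bochner_Integration.integrable_bound[OF integrable_std_normal_moment[of 0]]) simp_all
  then have "integrable lborel (\<lambda>s. ?g (0 + c * s))"
    using c by (intro lborel_integrable_real_affine) auto
  then show "integrable lborel ?f"
    unfolding f_g by (rule integrable_mult_right)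
  have "of_real c * (LINT s|lborel. ?g (0 + c * s)) = (LINT y|lborel. ?g y)"
    using lborel_integral_real_affine[of c ?g 0] c by (simp add: scaleR_conv_of_real)
  also have "\<dots> = char std_normal_distribution (2 * pi * v / c)"
    unfolding char_def by (subst integral_density) auto
  also have "\<dots> = of_real (exp (- pi * v\<^sup>2 / a))"
  proof -
    have "- (2 * pi * v / c)\<^sup>2 / 2 = - pi * v\<^sup>2 / a"
      using c(2) assms by (simp add: power_divide power_mult_distrib) (simp add: power2_eq_square)
    then show ?thesis
      by (simp only: char_std_normal_distribution)
  qed
  finally have "(LINT s|lborel. ?g (0 + c * s)) = of_real (exp (- pi * v\<^sup>2 / a) / c)"
    using c by (simp add: field_simps)
  then have "(LINT s|lborel. ?f s) = of_real (sqrt (2 * pi)) * of_real (exp (- pi * v\<^sup>2 / a) / c)"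
    unfolding f_g integral_mult_right_zero by (rule arg_cong)
  moreover have "sqrt (2 * pi) * (exp (- pi * v\<^sup>2 / a) / c) = a powr (- 1 / 2) * exp (- pi * v\<^sup>2 / a)"
  proof -
    have "a powr (- 1 / 2) = inverse (sqrt a)"
      using assms powr_minus[of a "1 / 2"] by (simp add: powr_half_sqrt)
    moreover have "c = sqrt (2 * pi) * sqrt a"
      by (simp add: c_def real_sqrt_mult)
    moreover have "sqrt (2 * pi) \<noteq> 0"
      by simp
    ultimately show ?thesis
      by (simp only: divide_inverse inverse_mult_distrib mult.assoc mult.left_commute[of "sqrt (2 * pi)"])
        (simp add: mult_ac)
  qed
  ultimately show "(LINT s|lborel. ?f s) = of_real (a powr (- 1 / 2) * exp (- pi * v\<^sup>2 / a))"
    by (simp only: flip: of_real_mult)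
qed

text \<open>In coordinates the integrand is a product of functions of one variable each, so Fubini's
  theorem reduces the integral to the one-dimensional case.\<close>

lemma integral_gaussian_cis:
  fixes v :: "'a::euclidean_space"
  assumes "0 < a"
  shows "(LINT s|lborel. of_real (exp (- pi * a * (norm s)\<^sup>2)) * cis (2 * pi * (v \<bullet> s))) =
    complex_of_real (a powr (- real DIM('a) / 2) * exp (- pi * (norm v)\<^sup>2 / a))"
proof -
  interpret product_sigma_finite "\<lambda>_::'a. lborel :: real measure" ..
  let ?f = "\<lambda>b s. complex_of_real (exp (- pi * a * s\<^sup>2)) * cis (2 * pi * ((v \<bullet> b) * s))"
  have cis_sum: "cis (sum g B) = (\<Prod>b\<in>B. cis (g b))" if "finite B" for g :: "'a \<Rightarrow> real" and B
    using that by induction (simp_all flip: cis_mult)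
  have norm_sum: "(norm u)\<^sup>2 = (\<Sum>b\<in>Basis. (u \<bullet> b)\<^sup>2)" for u :: 'a
    unfolding power2_norm_eq_inner by (subst euclidean_inner) (simp add: power2_eq_square)
  have prod_form: "complex_of_real (exp (- pi * a * (norm s)\<^sup>2)) * cis (2 * pi * (v \<bullet> s)) =
      (\<Prod>b\<in>Basis. ?f b (s \<bullet> b))" for s
    unfolding norm_sum euclidean_inner[of v s]
    by (simp add: sum_distrib_left exp_sum cis_sum prod.distrib flip: of_real_prod)
  have "(LINT s|lborel. complex_of_real (exp (- pi * a * (norm s)\<^sup>2)) * cis (2 * pi * (v \<bullet> s))) =
      (LINT s|lborel. (\<Prod>b\<in>Basis. ?f b (s \<bullet> b)))"
    by (simp only: prod_form)
  also have "\<dots> = (LINT s|(\<Pi>\<^sub>M b\<in>Basis. lborel). (\<Prod>b\<in>Basis. ?f b (s b)))"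
    by (subst lborel_eq, subst integral_distr) (auto simp: inner_sum_left_Basis
        intro!: Bochner_Integration.integral_cong prod.cong borel_measurable_continuous_onI continuous_intros)
  also have "\<dots> = (\<Prod>b\<in>Basis. LINT s|lborel. ?f b s)"
    by (rule product_integral_prod[OF finite_Basis integral_gaussian_cis_real(1)[OF assms]])
  also have "\<dots> = (\<Prod>b\<in>Basis. of_real (a powr (- 1 / 2) * exp (- pi * (v \<bullet> b)\<^sup>2 / a)))"
    by (simp only: integral_gaussian_cis_real[OF assms])
  also have "\<dots> = of_real ((a powr (- 1 / 2)) ^ DIM('a) * exp (\<Sum>b\<in>Basis. - pi * (v \<bullet> b)\<^sup>2 / a))"
    by (simp only: exp_sum[OF finite_Basis] prod.distrib prod_constant flip: of_real_prod)
  also have "(\<Sum>b\<in>Basis. - pi * (v \<bullet> b)\<^sup>2 / a) = - pi * (norm v)\<^sup>2 / a"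
    by (simp only: norm_sum sum_distrib_left sum_divide_distrib)
  also have "(a powr (- 1 / 2)) ^ DIM('a) = a powr (- real DIM('a) / 2)"
    using assms by (simp add: powr_powr flip: powr_realpow)
  finally show ?thesis .
qed

lemma inv_fourier_cmult: "inv_fourier (\<lambda>t. c * f t) = (\<lambda>\<omega>. c * inv_fourier f \<omega>)"
  by (simp add: fun_eq_iff inv_fourier_def mult.assoc)

text \<open>Translation and modulation trade places, and the width is inverted: after moving the centre to
  the origin only a centred Gaussian integral at frequency \<open>v + \<omega>\<close> remains.\<close>

lemma inv_fourier_gabor_atom:
  fixes x v :: "'a::euclidean_space"
  assumes "0 < a"
  shows "inv_fourier (gabor_atom a x v) =
    (\<lambda>\<omega>. of_real (a powr (- real DIM('a) / 2)) * cis (2 * pi * (v \<bullet> x)) * gabor_atom (1 / a) (- v) x \<omega>)"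
proof
  fix \<omega> :: 'a
  let ?f = "\<lambda>t. gabor_atom a x v t * cis (2 * pi * (\<omega> \<bullet> t))"
  have "inv_fourier (gabor_atom a x v) \<omega> = (LINT t|distr lborel borel ((+) x). ?f t)"
    by (simp add: inv_fourier_def lborel_distr_plus)
  also have "\<dots> = (LINT s|lborel. ?f (x + s))"
    by (rule integral_distr) (auto simp: gabor_atom_def intro!: borel_measurable_continuous_onI continuous_intros)
  also have "\<dots> = (LINT s|lborel. cis (2 * pi * ((v + \<omega>) \<bullet> x)) *
      (of_real (exp (- pi * a * (norm s)\<^sup>2)) * cis (2 * pi * ((v + \<omega>) \<bullet> s))))"
    by (rule Bochner_Integration.integral_cong)
      (simp_all add: gabor_atom_def cis_mult mult_ac algebra_simps inner_add_left inner_add_right)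
  also have "\<dots> = cis (2 * pi * ((v + \<omega>) \<bullet> x)) *
      of_real (a powr (- real DIM('a) / 2) * exp (- pi * (norm (v + \<omega>))\<^sup>2 / a))"
    by (simp only: integral_mult_right_zero integral_gaussian_cis[OF assms])
  also have "\<dots> = of_real (a powr (- real DIM('a) / 2)) * cis (2 * pi * (v \<bullet> x)) *
      gabor_atom (1 / a) (- v) x \<omega>"
    by (simp add: gabor_atom_def inner_add_left distrib_left add.commute[of v] inner_commute[of x] flip: cis_mult)
  finally show "inv_fourier (gabor_atom a x v) \<omega> = \<dots>" .
qed

lemma fourier_eq_inv_fourier: "fourier f \<omega> = inv_fourier f (- \<omega>)"
  by (simp add: fourier_def inv_fourier_def inner_commute)

lemma fourier_gabor_atom:
  "fourier (gabor_atom 1 y \<eta>) \<omega> = cis (2 * pi * (\<eta> \<bullet> y)) * gabor_atom 1 \<eta> (- y) \<omega>"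
proof -
  have "norm (\<eta> - \<omega>) = norm (\<omega> - \<eta>)" by (rule norm_minus_commute)
  then show ?thesis
    by (simp add: fourier_eq_inv_fourier inv_fourier_gabor_atom gabor_atom_def)
qed

section \<open>The Gabor matrix of a Fourier multiplier\<close>

text \<open>The Fourier transform of \<open>\<F>(\<pi>(y, \<eta>) g) \<cdot> \<F>\<^sup>-\<^sup>1(cnj (\<pi>(x, \<xi>) g))\<close> in closed form. The second
  factor is a phase, constant in \<open>r\<close>; it is kept because the transform of this function has to match
  that product exactly.\<close>

definition multiplier_gabor_kernel ::
  "'a::euclidean_space \<Rightarrow> 'a \<Rightarrow> 'a \<Rightarrow> 'a \<Rightarrow> 'a \<Rightarrow> complex" where
  "multiplier_gabor_kernel x y \<xi> \<eta> = (\<lambda>r.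
     of_real (2 powr (- real DIM('a) / 2) * exp (- (pi / 2) * (norm (\<xi> - \<eta>))\<^sup>2)) *
     cis (2 * pi * (\<eta> \<bullet> y - \<xi> \<bullet> x + ((\<xi> + \<eta>) /\<^sub>R 2) \<bullet> (x - y))) *
     gabor_atom (1 / 2) (x - y) (- ((\<xi> + \<eta>) /\<^sub>R 2)) r)"

lemma multiplier_gabor_kernel_schwartz: "multiplier_gabor_kernel x y \<xi> \<eta> \<in> schwartz"
  unfolding multiplier_gabor_kernel_def by (rule schwartz_gabor_atom) simp

lemma norm_multiplier_gabor_kernel:
  fixes x y \<xi> \<eta> r :: "'a::euclidean_space"
  shows "norm (multiplier_gabor_kernel x y \<xi> \<eta> r) = 2 powr (- real DIM('a) / 2) *
    exp (- (pi / 2) * ((norm (\<xi> - \<eta>))\<^sup>2 + (norm (x - y - r))\<^sup>2))"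
  by (simp add: multiplier_gabor_kernel_def norm_mult norm_gabor_atom norm_minus_commute[of r]
      distrib_left flip: exp_add)

text \<open>Both sides are explicit: the Gaussian factors agree by the parallelogram law, the phases by
  collecting terms, and the factor \<open>2 powr (- DIM / 2)\<close> cancels the one produced by transforming a
  Gaussian of parameter \<open>1 / 2\<close>.\<close>

lemma inv_fourier_multiplier_gabor_kernel:
  "inv_fourier (multiplier_gabor_kernel x y \<xi> \<eta>) =
     (\<lambda>\<omega>. fourier (gabor_atom 1 y \<eta>) \<omega> * inv_fourier (gabor_atom 1 x (- \<xi>)) \<omega>)"
proof
  fix \<omega> :: 'a
  define m where "m = (\<xi> + \<eta>) /\<^sub>R 2"
  have parallelogram: "(norm (\<omega> - \<eta>))\<^sup>2 + (norm (\<omega> - \<xi>))\<^sup>2 =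
      2 * (norm (\<omega> - m))\<^sup>2 + (norm (\<xi> - \<eta>))\<^sup>2 / 2"
    by (simp add: m_def power2_norm_eq_inner inner_diff_left inner_diff_right inner_add_left inner_add_right
        inner_commute field_simps)
  have phase: "cis (2 * pi * (\<eta> \<bullet> y - \<xi> \<bullet> x) + 2 * pi * ((x - y) \<bullet> \<omega>)) =
      cis (2 * pi * (\<eta> \<bullet> y)) * cis (2 * pi * (- y \<bullet> \<omega>)) *
      (cis (2 * pi * (- \<xi> \<bullet> x)) * cis (2 * pi * (x \<bullet> \<omega>)))"
    by (simp add: cis_mult algebra_simps inner_diff_left)
  have modulus: "complex_of_real (exp (- pi * ((norm (\<omega> - \<eta>))\<^sup>2 + (norm (\<omega> - \<xi>))\<^sup>2))) =
      of_real (exp (- pi * (norm (\<omega> - \<eta>))\<^sup>2)) * of_real (exp (- pi * (norm (\<omega> - \<xi>))\<^sup>2))"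
    by (simp add: distrib_left flip: of_real_mult exp_add)
  have powr_cancel: "2 powr (- real DIM('a) / 2) * (1 / 2) powr (- real DIM('a) / 2) = (1::real)"
    by (simp flip: powr_mult)
  have "inv_fourier (multiplier_gabor_kernel x y \<xi> \<eta>) \<omega> =
      of_real ((2 powr (- real DIM('a) / 2) * (1 / 2) powr (- real DIM('a) / 2)) *
        exp (- (pi / 2) * (norm (\<xi> - \<eta>))\<^sup>2)) *
      (cis (2 * pi * (\<eta> \<bullet> y - \<xi> \<bullet> x + m \<bullet> (x - y))) * cis (2 * pi * (- m \<bullet> (x - y)))) *
      gabor_atom 2 m (x - y) \<omega>"
    unfolding multiplier_gabor_kernel_def inv_fourier_cmult m_def[symmetric]
    by (simp add: inv_fourier_gabor_atom mult_ac)
  also have "\<dots> = of_real (exp (- (pi / 2) * (norm (\<xi> - \<eta>))\<^sup>2)) * cis (2 * pi * (\<eta> \<bullet> y - \<xi> \<bullet> x)) *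
      gabor_atom 2 m (x - y) \<omega>"
    unfolding powr_cancel by (simp add: cis_mult algebra_simps)
  also have "\<dots> = cis (2 * pi * (\<eta> \<bullet> y - \<xi> \<bullet> x) + 2 * pi * ((x - y) \<bullet> \<omega>)) *
     of_real (exp (- pi * ((norm (\<omega> - \<eta>))\<^sup>2 + (norm (\<omega> - \<xi>))\<^sup>2)))"
    unfolding parallelogram gabor_atom_def by (simp add: distrib_left mult_ac flip: cis_mult of_real_mult exp_add)
  also have "\<dots> = fourier (gabor_atom 1 y \<eta>) \<omega> * inv_fourier (gabor_atom 1 x (- \<xi>)) \<omega>"
    unfolding phase modulus
    by (simp add: fourier_gabor_atom inv_fourier_gabor_atom gabor_atom_def mult_ac)
  finally show "inv_fourier (multiplier_gabor_kernel x y \<xi> \<eta>) \<omega> = \<dots>" .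
qed

section \<open>Gabor matrices as values of the kernel and of the symbol\<close>

text \<open>Conjugating \<open>\<pi>(y, \<eta>) g\<close> reverses the sign of the frequency \<open>\<eta>\<close>, which is why \<open>- \<eta>\<close> appears
  on the right.\<close>

lemma gabor_matrix_eq_stft_kernel:
  assumes "is_schwartz_kernel T kT"
  shows "gabor_matrix gaussian T (y, \<eta>) (x, \<xi>) =
    stft (\<lambda>(s, t). of_real (exp (- pi * ((norm s)\<^sup>2 + (norm t)\<^sup>2)))) kT ((x, y), (\<xi>, - \<eta>))"
proof -
  have "tensor (gabor_atom 1 x \<xi>) (gabor_atom 1 y (- \<eta>)) =
      tf_shift ((x, y), (\<xi>, - \<eta>)) (\<lambda>(s, t). of_real (exp (- pi * ((norm s)\<^sup>2 + (norm t)\<^sup>2))))"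
    by (simp add: fun_eq_iff tensor_def tf_shift_def gabor_atom_def inner_diff_right distrib_left exp_add
        right_diff_distrib exp_diff exp_minus divide_inverse mult_ac flip: cis_mult cis_divide)
  then show ?thesis
    using assms
    by (simp add: gabor_matrix_def stft_def tf_shift_gaussian is_schwartz_kernel_def cnj_gabor_atom
        schwartz_gabor_atom(2))
qed

text \<open>Unfolding the definitions leaves \<open>\<sigma>\<close> applied to the product of the two transforms, which
  \<open>inv_fourier_multiplier_gabor_kernel\<close> recognises as
  the inverse transform of the kernel function. The multiplier and
  \<open>\<F>\<^sup>-\<^sup>1 \<sigma>\<close> are defined by these formulas only at Schwartz functions, which is why atoms, their
  inverse transforms and the kernel function have to be Schwartz.\<close>

lemma gabor_matrix_fourier_multiplier:
  assumes "\<And>f. f \<in> schwartz \<Longrightarrow> T f = fourier_multiplier \<sigma> f"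
  shows "gabor_matrix gaussian T (y, \<eta>) (x, \<xi>) =
    tempered_inv_fourier \<sigma> (multiplier_gabor_kernel x y \<xi> \<eta>)"
proof -
  have "inv_fourier (gabor_atom 1 x (- \<xi>)) \<in> schwartz"
    by (simp add: inv_fourier_gabor_atom schwartz_gabor_atom)
  then show ?thesis
    using assms[OF schwartz_gabor_atom(2)[of 1]]
    by (simp add: gabor_matrix_def tf_shift_gaussian pairing_def cnj_gabor_atom fourier_multiplier_def
        tempered_inv_fourier_def tempered_times_def schwartz_gabor_atom multiplier_gabor_kernel_schwartz
        inv_fourier_multiplier_gabor_kernel)
qed

theorem proposition3p5:
  shows "(\<forall>(T :: (real^'d \<Rightarrow> complex) \<Rightarrow> ((real^'d \<Rightarrow> complex) \<Rightarrow> complex)) kT.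
            linear_continuous_operator T \<and> is_schwartz_kernel T kT \<longrightarrow>
            (\<forall>x y \<xi> \<eta>.
               norm (gabor_matrix gaussian T (y, \<eta>) (x, \<xi>)) =
               norm (stft (\<lambda>(s, t). of_real (exp (- pi * ((norm s)\<^sup>2 + (norm t)\<^sup>2)))) kT
                       ((x, y), (\<xi>, - \<eta>)))))
       \<and> (\<exists>H :: real^'d \<Rightarrow> real^'d \<Rightarrow> real^'d \<Rightarrow> real^'d \<Rightarrow> real^'d \<Rightarrow> complex.
            (\<forall>x y \<xi> \<eta>. H x y \<xi> \<eta> \<in> schwartz \<and>
               (\<forall>r. norm (H x y \<xi> \<eta> r) =
                    2 powr (- real CARD('d) / 2) *
                    exp (- (pi / 2) * ((norm (\<xi> - \<eta>))\<^sup>2 + (norm (x - y - r))\<^sup>2)))) \<and>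
            (\<forall>(T :: (real^'d \<Rightarrow> complex) \<Rightarrow> ((real^'d \<Rightarrow> complex) \<Rightarrow> complex)) \<sigma> E.
               linear_continuous_operator T \<and> \<sigma> \<in> tempered \<and>
               (\<forall>f\<in>schwartz. T f = fourier_multiplier \<sigma> f) \<and>
               E = tempered_inv_fourier \<sigma> \<longrightarrow>
               (\<forall>x y \<xi> \<eta>.
                  norm (gabor_matrix gaussian T (y, \<eta>) (x, \<xi>)) = norm (E (H x y \<xi> \<eta>)))))"
proof (intro conjI exI[of _ multiplier_gabor_kernel] allI impI)
  fix x y \<xi> \<eta> r :: "real^'d"
  show "multiplier_gabor_kernel x y \<xi> \<eta> \<in> schwartz"
    by (rule multiplier_gabor_kernel_schwartz)
  show "norm (multiplier_gabor_kernel x y \<xi> \<eta> r) = 2 powr (- real CARD('d) / 2) *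
      exp (- (pi / 2) * ((norm (\<xi> - \<eta>))\<^sup>2 + (norm (x - y - r))\<^sup>2))"
    by (simp add: norm_multiplier_gabor_kernel)
next
  fix T :: "(real^'d \<Rightarrow> complex) \<Rightarrow> ((real^'d \<Rightarrow> complex) \<Rightarrow> complex)" and kT x y \<xi> \<eta>
  assume "linear_continuous_operator T \<and> is_schwartz_kernel T kT"
  then have "is_schwartz_kernel T kT" ..
  then show "norm (gabor_matrix gaussian T (y, \<eta>) (x, \<xi>)) =
      norm (stft (\<lambda>(s, t). of_real (exp (- pi * ((norm s)\<^sup>2 + (norm t)\<^sup>2)))) kT ((x, y), (\<xi>, - \<eta>)))"
    by (simp only: gabor_matrix_eq_stft_kernel)
next
  fix T :: "(real^'d \<Rightarrow> complex) \<Rightarrow> ((real^'d \<Rightarrow> complex) \<Rightarrow> complex)" and \<sigma> E x y \<xi> \<eta>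
  assume "linear_continuous_operator T \<and> \<sigma> \<in> tempered \<and>
    (\<forall>f\<in>schwartz. T f = fourier_multiplier \<sigma> f) \<and> E = tempered_inv_fourier \<sigma>"
  then show "norm (gabor_matrix gaussian T (y, \<eta>) (x, \<xi>)) = norm (E (multiplier_gabor_kernel x y \<xi> \<eta>))"
    using gabor_matrix_fourier_multiplier[of T \<sigma> y \<eta> x \<xi>] by simp
qed

end
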